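(* Let $q$ be an odd prime power with $q\ge5$, let $n\ge2$ with $q\equiv1\pmod n$, and let $a\in\mathbb{F}_q^*$ be such that $-a$ has multiplicative order $n$. Let $b\in\mathbb{F}_q^*$ be arbitrary and $\mathbf{O}_n=\{x_1,\ldots,x_n\}$ with $x_i=b\sum_{j=0}^{n-i}(-1/a)^{j+1}$ for $1\le i\le n$. Let $F:\mathbb{F}_q\to\mathbb{F}_q$ be defined by $F(\delta)=(a+1)\delta+b$ for $\delta\notin\mathbf{O}_n$, $F(x_i)=ax_{i-1}+x_i+b$ for $2\le i\le n$, and $F(x_1)=0$. Then $|V_F|=q-n$; moreover exactly $n$ elements of $\mathbb{F}_q$ have no preimage under $F$, exactly $q-n-1$ elements have exactly one preimage, exactly one element has exactly $n+1$ preimages, and no element has any other number of preimages.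
   Context: $V_F=\{F(c):c\in\mathbb{F}_q\}$ denotes the value set of $F$. (Here $x_1=0$ and $x_n=-b/a$, and $F=f+x$ where $f$ is the permutation with $f=g$ off $\mathbf{O}_n$, $f(x_i)=g(x_{i-1})$ for $i\ge2$, $f(x_1)=g(x_n)=0$, $g(x)=ax+b$.) *)

theory Defs
  imports "HOL-Library.Cardinality" "HOL-Number_Theory.Number_Theory" "HOL-Number_Theory.Prime_Powers"
begin

text \<open>
  The order of an element, for multiplicative structures given by type classes; as in
  HOL-Algebra and for \<^const>\<open>Pocklington.ord\<close>, the value \<open>0\<close> stands for infinite order.
\<close>

definition mult_order :: "'a::monoid_mult \<Rightarrow> nat" where
  "mult_order x = (if \<exists>k>0. x ^ k = 1 then (LEAST k. k > 0 \<and> x ^ k = 1) else 0)"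

end

theory Submission
  imports Defs
begin

text \<open>
  Put \<open>r = -1/a\<close> and \<open>L \<delta> = (a + 1) \<delta> + b\<close>. Since \<open>r\<close> has order \<open>n \<ge> 2\<close>, the map \<open>L\<close> is a bijection, and
  the sums telescope to \<open>L (x\<^sub>i) = b r\<^sup>k\<close> with \<open>k = n - i + 1\<close>. Hence the \<open>x\<^sub>i\<close> are \<open>n\<close> distinct
  elements, none of them the root of \<open>L\<close>, and \<open>F (x\<^sub>i) = 0\<close> for all \<open>i\<close>. So \<open>F\<close> arises from the
  bijection \<open>L\<close> by moving the \<open>n\<close> values \<open>L (x\<^sub>i)\<close> to the value \<open>0\<close>, which is attained once
  elsewhere.
\<close>

lemma mult_order_least:
  assumes "0 < k" "x ^ k = 1"
  shows "mult_order x \<le> k"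
  unfolding mult_order_def using assms by (auto intro: Least_le)

text \<open>Redirecting \<open>S\<close> to \<open>z\<close> empties the fibres over
  \<open>L\<close>
  S\<open>. The fibre over\<close>z\<open>becomes\<close>S\<open>plus the single\<close>L\<open>-preimage of\<close>z\<open>, which lies outside\<close>S\<open>because\<close>z\<open>is not in\<close>L
  \<open>S\<close>. All other fibres stay singletons.\<close>

lemma fibres_collapsed_bij:
  fixes F L :: "'a::finite \<Rightarrow> 'a"
  assumes "bij L" and off: "\<And>d. d \<notin> S \<Longrightarrow> F d = L d" and on: "\<And>d. d \<in> S \<Longrightarrow> F d = z"
    and z: "z \<notin> L ` S" and "S \<noteq> {}"
  shows "card (range F) = CARD('a) - card S
    \<and> card {y. card (F -` {y}) = 0} = card S
    \<and> card {y. card (F -` {y}) = 1} = CARD('a) - card S - 1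
    \<and> card {y. card (F -` {y}) = card S + 1} = 1
    \<and> (\<forall>y. card (F -` {y}) \<in> {0, 1, card S + 1})"
proof -
  have inj: "inj L" and surj: "surj L"
    using \<open>bij L\<close> by (auto simp: bij_def)
  have cL: "card (L ` S) = card S"
    by (intro card_image inj_on_subset[OF inj]) auto
  \<comment> \<open>Keeps \<open>card S + 1\<close> apart from 1, so that \<open>z\<close> is not
    counted among the points with a single preimage.\<close>
  have pos: "card S > 0"
    using \<open>S \<noteq> {}\<close> by (simp add: card_gt_0_iff)
  have fz: "card (F -` {z}) = card S + 1"
  proof -
    obtain c where c: "L c = z"
      using surj by (metis surjD)
    have "c \<notin> S" using z c by auto
    have "F d = z \<longleftrightarrow> d \<in> insert c S" for d
      using off[of d] on[of d] c inj_eq[OF inj, of d c] by (cases "d \<in> S") auto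
    then have "F -` {z} = insert c S" by auto
    then show ?thesis using \<open>c \<notin> S\<close> by simp
  qed
  have f0: "card (F -` {y}) = 0" if "y \<in> L ` S" for y
  proof -
    have "F d \<noteq> y" for d
      using that off[of d] on[of d] z by (cases "d \<in> S") (auto simp: inj_eq[OF inj])
    then have "F -` {y} = {}" by auto
    then show ?thesis by simp
  qed
  have f1: "card (F -` {y}) = 1" if y: "y \<notin> L ` S" "y \<noteq> z" for y
  proof -
    obtain c where c: "L c = y"
      using surj by (metis surjD)
    have "F d = y \<longleftrightarrow> d = c" for d
      using off[of d] on[of d] c y inj_eq[OF inj, of d c] by (cases "d \<in> S") auto
    then have "F -` {y} = {c}" by auto
    then show ?thesis by simp
  qed
  have fibre: "card (F -` {y}) = (if y \<in> L ` S then 0 else if y = z then card S + 1 else 1)" for y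
    using f0[of y] f1[of y] fz by (cases "y \<in> L ` S"; cases "y = z") (simp_all only: if_True if_False simp_thms)
  have e0: "{y. card (F -` {y}) = 0} = L ` S"
    unfolding fibre by auto
  have e1: "{y. card (F -` {y}) = 1} = UNIV - L ` S - {z}"
    unfolding fibre using pos by auto
  have en: "{y. card (F -` {y}) = card S + 1} = {z}"
    unfolding fibre using pos z by auto
  have "range F = - {y. card (F -` {y}) = 0}"
    by (auto simp: card_eq_0_iff)
  then have "card (range F) = CARD('a) - card S"
    unfolding e0 by (simp add: Compl_eq_Diff_UNIV card_Diff_subset cL)
  moreover have "card (UNIV - L ` S - {z}) = CARD('a) - card S - 1"
    using z by (simp add: card_Diff_subset cL)
  moreover have "\<forall>y. card (F -` {y}) \<in> {0, 1, card S + 1}"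
    unfolding fibre by simp
  ultimately show ?thesis
    unfolding e0 e1 en using cL by simp
qed

text \<open>With \<open>r = - 1 / a\<close> one has \<open>a * r = - 1\<close>, so
  \<open>(a + 1) * r ^ (j + 1) = r ^ (j + 1) - r ^ j\<close> and the sum telescopes.\<close>

lemma scaled_geometric_sum:
  fixes a :: "'a::field"
  assumes "a \<noteq> 0"
  shows "(a + 1) * (\<Sum>j=0..m. (- 1 / a) ^ (j + 1)) = (- 1 / a) ^ (m + 1) - 1"
proof (induction m)
  case 0
  show ?case using assms by (simp add: field_simps)
next
  case (Suc m)
  have "(a + 1) * (- 1 / a) ^ (m + 2) = (- 1 / a) ^ (m + 2) - (- 1 / a) ^ (m + 1)"
    using assms by (simp add: field_simps)
  with Suc show ?case by (simp add: distrib_left)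
qed

theorem theorem9:
  fixes q n :: nat
    and a b :: "'a::{field, finite}"
    and x :: "nat \<Rightarrow> 'a"
    and On :: "'a set"
    and F :: "'a \<Rightarrow> 'a"
  assumes q_field: "CARD('a) = q"
    and q_odd_prime_power: "primepow q" "odd q"
    and q_ge: "q \<ge> 5"
    and n_ge: "n \<ge> 2"
    and q_cong: "[q = 1] (mod n)"
    and a_nz: "a \<noteq> 0"
    and a_order: "mult_order (- a) = n"
    and b_nz: "b \<noteq> 0"
    and x_def: "\<forall>i\<in>{1..n}. x i = b * (\<Sum>j=0..n-i. (- 1 / a) ^ (j + 1))"
    and On_def: "On = x ` {1..n}"
    and F_off: "\<forall>\<delta>. \<delta> \<notin> On \<longrightarrow> F \<delta> = (a + 1) * \<delta> + b"
    and F_x: "\<forall>i\<in>{2..n}. F (x i) = a * x (i - 1) + x i + b"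
    and F_x1: "F (x 1) = 0"
  shows "card (range F) = q - n
    \<and> card {y. card (F -` {y}) = 0} = n
    \<and> card {y. card (F -` {y}) = 1} = q - n - 1
    \<and> card {y. card (F -` {y}) = n + 1} = 1
    \<and> (\<forall>y. card (F -` {y}) \<in> {0, 1, n + 1})"
proof -
  define r where "r = - 1 / a"
  define L where "L = (\<lambda>\<delta>. (a + 1) * \<delta> + b)"
  have r_nz: "r \<noteq> 0" and ar: "a * r = - 1" using a_nz by (auto simp: r_def)
  \<comment> \<open>\<open>r\<close> is the inverse of \<open>- a\<close>, so
    \<open>r ^ k = 1\<close> would contradict the minimality of \<open>n\<close>.\<close>
  have r_order: "r ^ k \<noteq> 1" if "0 < k" "k < n" for k
  proof
    assume "r ^ k = 1"
    moreover have "(- a) ^ k * r ^ k = 1"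
      using ar by (simp flip: power_mult_distrib)
    ultimately have "(- a) ^ k = 1" by simp
    with that mult_order_least[of k "- a"] a_order show False by simp
  qed
  have a1: "a + 1 \<noteq> 0"
  proof
    assume "a + 1 = 0"
    then have "a = - 1" by (simp add: eq_neg_iff_add_eq_0)
    with r_order[of 1] n_ge show False by (simp add: r_def)
  qed
  \<comment> \<open>The \<open>- 1\<close> left by telescoping, multiplied by \<open>b\<close>,
    cancels the constant term of \<open>L\<close>.\<close>
  have Lx: "L (x i) = b * r ^ (n - i + 1)" if "i \<in> {1..n}" for i
  proof -
    have "L (x i) = b * ((a + 1) * (\<Sum>j=0..n-i. (- 1 / a) ^ (j + 1))) + b"
      using that x_def unfolding L_def by (simp only: mult.left_commute)
    then show ?thesis
      unfolding scaled_geometric_sum[OF a_nz] by (simp add: r_def algebra_simps)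
  qed
  have "inj_on x {1..n}"
  proof (rule linorder_inj_onI)
    fix i j assume ij: "i < j" "i \<in> {1..n}" "j \<in> {1..n}"
    \<comment> \<open>The two values of \<open>L\<close> differ by the factor
      \<open>r ^ (j - i)\<close>, where \<open>0 < j - i < n\<close>.\<close>
    have "n - i + 1 = (n - j + 1) + (j - i)" using ij by simp
    then have "r ^ (n - i + 1) = r ^ (n - j + 1) * r ^ (j - i)"
      by (simp only: power_add)
    moreover have "r ^ (j - i) \<noteq> 1" using ij by (intro r_order) auto
    ultimately have "L (x i) \<noteq> L (x j)"
      using Lx ij b_nz r_nz by simp
    then show "x i \<noteq> x j" by auto
  qed auto
  then have card_On: "card On = n"
    by (simp add: On_def card_image)
  have "bij L"
    unfolding bij_def
  proof
    show "inj L" using a1 by (auto simp: L_def inj_on_def)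
    then show "surj L" by (simp add: finite_UNIV_inj_surj)
  qed
  have F_On: "F d = 0" if d: "d \<in> On" for d
  proof -
    obtain i where i: "i \<in> {1..n}" "d = x i" using d unfolding On_def by blast
    show ?thesis
    proof (cases "i = 1")
      case True
      with i F_x1 show ?thesis by simp
    next
      case False
      with i have i2: "i \<in> {2..n}" "i - 1 \<in> {1..n}" by auto
      \<comment> \<open>Lowering the index by one multiplies the value of \<open>L\<close> by
        \<open>r\<close>; since \<open>a * r = - 1\<close>, the two terms of
        \<open>(a + 1) * F d\<close> below cancel.\<close>
      then have "n - (i - 1) + 1 = Suc (n - i + 1)" by auto
      then have "L (x (i - 1)) = r * L (x i)"
        using Lx[OF i2(2)] Lx[OF i(1)] by simp
      then have "a * L (x (i - 1)) = - L (x i)"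
        using ar by (simp flip: mult.assoc)
      moreover have "(a + 1) * F d = a * L (x (i - 1)) + L (x i)"
        using F_x i2 i by (simp add: L_def algebra_simps)
      ultimately show ?thesis using a1 by simp
    qed
  qed
  \<comment> \<open>Hence the root of \<open>L\<close> lies outside \<open>On\<close> and is the
    extra preimage of 0.\<close>
  have "0 \<notin> L ` On"
    using Lx b_nz r_nz by (auto simp: On_def)
  moreover have "On \<noteq> {}" using card_On n_ge by auto
  moreover have "F d = L d" if "d \<notin> On" for d
    using that F_off by (simp add: L_def)
  ultimately show ?thesis
    using fibres_collapsed_bij[OF \<open>bij L\<close>, of On F 0] F_On card_On q_field by simp
qed

end
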